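(* Let $X,V$ be complex Hilbert spaces, let $A_0$ be the generator of a unitary group $(T_0(t))_{t\in\mathbb{R}}$ on $X$, let $B\in L^2_{\mathrm{loc}}(\mathbb{R}_+;\mathcal{B}(V,X))$, and let $A(t)=A_0-B(t)B(t)^*$, $D(A(t))=D(A_0)$, $t\ge0$, with associated evolution family of contractions $(U(t,s))_{t\ge s\ge0}$. Let $\tau>0$. Then for all $x\in X$ we have $$\frac{1}{c_\tau^{2}}\int_0^\tau\|B(t)^*T_0(t)x\|^2\,dt\le\int_0^\tau\|B(t)^*U(t,0)x\|^2\,dt\le\int_0^\tau\|B(t)^*T_0(t)x\|^2\,dt,$$ where $c_\tau=1+\|B\|_{L^2(0,\tau)}^2$. In particular, given any subset $Z$ of $X$, the pair $(B^*,A)$ is approximately (respectively, exactly) $Z$-observable on $(0,\tau)$ if and only if $(B^*,A_0)$ is approximately (respectively, exactly) $Z$-observable on $(0,\tau)$.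
   Context: An evolution family on $X$ is a family $(U(t,s))_{t\ge s\ge0}$ in $\mathcal{B}(X)$ with $U(t,t)=I$, $U(t,r)U(r,s)=U(t,s)$ for $t\ge r\ge s\ge0$, and $(t,s)\mapsto U(t,s)x$ continuous for every $x\in X$. The evolution family of contractions associated with $A(t)=A_0-B(t)B(t)^*$ is the one for which, for every $x\in X$, $z(t)=U(t,0)x$ satisfies $$z(t)=T_0(t)x-\int_0^tT_0(t-s)B(s)B(s)^*z(s)\,ds,\quad t\ge0;$$ such a family exists. The norm is $\|B\|_{L^2(0,\tau)}^2=\int_0^\tau\|B(t)\|_{\mathcal{B}(V,X)}^2\,dt$. For $Z\subseteq X$, the pair $(B^*,A)$ is approximately $Z$-observable on $(0,\tau)$ if for all $x\in Z$ the condition $\int_0^\tau\|B(t)^*U(t,0)x\|^2\,dt=0$ implies $x=0$, and exactly $Z$-observable on $(0,\tau)$ if there is $\kappa>0$ with $\int_0^\tau\|B(t)^*U(t,0)x\|^2\,dt\ge\kappa^2\|x\|^2$ for all $x\in Z$. The same notions for $(B^*,A_0)$ are obtained by replacing $U(t,0)$ with $T_0(t)$. *)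

theory Defs
  imports "HOL-Analysis.Analysis"
begin

section \<open>Complex Hilbert spaces\<close>

text \<open>Norm and topology are those of the underlying real inner product
  \<open>Re \<langle>x, y\<rangle>\<close>; \<open>cinner\<close> is linear in its first argument.\<close>

class complex_inner = real_inner +
  fixes scaleC :: "complex \<Rightarrow> 'a \<Rightarrow> 'a" (infixr "*\<^sub>C" 75)
    and cinner :: "'a \<Rightarrow> 'a \<Rightarrow> complex"
  assumes scaleC_add_right: "c *\<^sub>C (x + y) = c *\<^sub>C x + c *\<^sub>C y"
    and scaleC_add_left: "(c + d) *\<^sub>C x = c *\<^sub>C x + d *\<^sub>C x"
    and scaleC_scaleC: "c *\<^sub>C d *\<^sub>C x = (c * d) *\<^sub>C x"
    and scaleR_scaleC: "r *\<^sub>R x = complex_of_real r *\<^sub>C x"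
    and cinner_commute: "cinner x y = cnj (cinner y x)"
    and cinner_add_left: "cinner (x + y) z = cinner x z + cinner y z"
    and cinner_scaleC_left: "cinner (c *\<^sub>C x) y = c * cinner x y"
    and inner_eq_Re_cinner: "inner x y = Re (cinner x y)"

class chilbert_space = complex_inner + complete_space
begin

subclass banach ..

end

instantiation complex :: chilbert_space
begin

definition scaleC_complex :: "complex \<Rightarrow> complex \<Rightarrow> complex"
  where "scaleC_complex c x = c * x"

definition cinner_complex :: "complex \<Rightarrow> complex \<Rightarrow> complex"
  where "cinner_complex x y = x * cnj y"

instance
  by standard
    (simp_all add: scaleC_complex_def cinner_complex_def algebra_simps scaleR_conv_of_real
      inner_complex_def)

end

section \<open>Bounded operators\<close>

text \<open>The type \<open>'a \<Rightarrow>\<^sub>L 'b\<close> consists of the bounded real-linear operators. The space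
  \<open>\<B>(X, Y)\<close> of the complex theory is its closed subspace of operators satisfying
  \<open>clinear_op\<close>, with the same operator norm.\<close>

definition clinear_op :: "('a::complex_inner \<Rightarrow>\<^sub>L 'b::complex_inner) \<Rightarrow> bool"
  where "clinear_op F \<longleftrightarrow> (\<forall>c x. blinfun_apply F (c *\<^sub>C x) = c *\<^sub>C blinfun_apply F x)"

definition cadjoint :: "('a::chilbert_space \<Rightarrow>\<^sub>L 'b::chilbert_space) \<Rightarrow> ('b \<Rightarrow>\<^sub>L 'a)"
  where "cadjoint F = (THE G. \<forall>x y. cinner (blinfun_apply F x) y = cinner x (blinfun_apply G y))"

definition unitary_op :: "('a::complex_inner \<Rightarrow>\<^sub>L 'a) \<Rightarrow> bool"
  where "unitary_op F \<longleftrightarrow> clinear_op F \<and> surj (blinfun_apply F) \<and>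
    (\<forall>x y. cinner (blinfun_apply F x) (blinfun_apply F y) = cinner x y)"

section \<open>Unitary groups and their generators\<close>

definition unitary_group :: "(real \<Rightarrow> 'a::complex_inner \<Rightarrow>\<^sub>L 'a) \<Rightarrow> bool"
  where "unitary_group T \<longleftrightarrow>
    (\<forall>t. unitary_op (T t)) \<and> T 0 = id_blinfun \<and> (\<forall>s t. T (s + t) = T s o\<^sub>L T t) \<and>
    (\<forall>x. continuous_on UNIV (\<lambda>t. blinfun_apply (T t) x))"

text \<open>Unbounded operators are given by their graphs; the domain of \<open>A\<close> is \<open>Domain A\<close>.\<close>

definition generator :: "(real \<Rightarrow> 'a::complex_inner \<Rightarrow>\<^sub>L 'a) \<Rightarrow> ('a \<times> 'a) set"
  where "generator T =
    {(x, y). ((\<lambda>h. (blinfun_apply (T h) x - x) /\<^sub>R h) \<longlongrightarrow> y) (at 0)}"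

definition damped :: "('a \<times> 'a) set \<Rightarrow> ('v::chilbert_space \<Rightarrow>\<^sub>L 'a::chilbert_space) \<Rightarrow> ('a \<times> 'a) set"
  where "damped A\<^sub>0 F =
    {(x, y - blinfun_apply F (blinfun_apply (cadjoint F) x)) | x y. (x, y) \<in> A\<^sub>0}"

lemma Domain_damped: "Domain (damped A\<^sub>0 F) = Domain A\<^sub>0"
  by (auto simp: damped_def)

section \<open>The space \<open>L\<^sup>2\<^sub>l\<^sub>o\<^sub>c\<close> of operator-valued functions\<close>

text \<open>Measurability in the sense of Bochner. For a target that need not be separable this is
  stronger than Borel measurability.\<close>

definition strongly_measurable :: "'s measure \<Rightarrow> ('s \<Rightarrow> 'b::topological_space) \<Rightarrow> bool"
  where "strongly_measurable M f \<longleftrightarrow>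
    (\<exists>s. (\<forall>i::nat. simple_function M (s i)) \<and> (AE t in M. (\<lambda>i. s i t) \<longlonglongrightarrow> f t))"

definition L2_loc :: "(real \<Rightarrow> 'v::complex_inner \<Rightarrow>\<^sub>L 'x::complex_inner) \<Rightarrow> bool"
  where "L2_loc B \<longleftrightarrow> (\<forall>t\<ge>0. clinear_op (B t)) \<and>
    (\<forall>T>0. strongly_measurable (lebesgue_on {0..T}) B \<and>
      set_integrable lebesgue {0..T} (\<lambda>t. (norm (B t))\<^sup>2))"

definition L2_norm_sq :: "(real \<Rightarrow> 'v::complex_inner \<Rightarrow>\<^sub>L 'x::complex_inner) \<Rightarrow> real \<Rightarrow> real"
  where "L2_norm_sq B \<tau> = (LINT t:{0..\<tau>}|lebesgue. (norm (B t))\<^sup>2)"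

section \<open>Evolution families\<close>

text \<open>Only the values \<open>U t s\<close> with \<open>t \<ge> s \<ge> 0\<close> are relevant.\<close>

definition evolution_family :: "(real \<Rightarrow> real \<Rightarrow> 'a::complex_inner \<Rightarrow>\<^sub>L 'a) \<Rightarrow> bool"
  where "evolution_family U \<longleftrightarrow>
    (\<forall>s\<ge>0. \<forall>t\<ge>s. clinear_op (U t s)) \<and>
    (\<forall>t\<ge>0. U t t = id_blinfun) \<and>
    (\<forall>s\<ge>0. \<forall>r\<ge>s. \<forall>t\<ge>r. U t r o\<^sub>L U r s = U t s) \<and>
    (\<forall>x. continuous_on {(t, s). 0 \<le> s \<and> s \<le> t} (\<lambda>(t, s). blinfun_apply (U t s) x))"

text \<open>The library's Bochner integral requires a separable target, so the \<open>X\<close>-valued integral is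
  the gauge integral. It extends the Bochner integral, and for \<open>B\<close> in \<open>L\<^sup>2\<^sub>l\<^sub>o\<^sub>c\<close>
  and \<open>U\<close> an evolution family the integrand below is Bochner integrable, so the two agree.\<close>

definition associated_evolution_family ::
    "(real \<Rightarrow> 'x::chilbert_space \<Rightarrow>\<^sub>L 'x) \<Rightarrow> (real \<Rightarrow> 'v::chilbert_space \<Rightarrow>\<^sub>L 'x) \<Rightarrow>
      (real \<Rightarrow> real \<Rightarrow> 'x \<Rightarrow>\<^sub>L 'x) \<Rightarrow> bool"
  where "associated_evolution_family T\<^sub>0 B U \<longleftrightarrow>
    evolution_family U \<and> (\<forall>s\<ge>0. \<forall>t\<ge>s. norm (U t s) \<le> 1) \<and>
    (\<forall>x. \<forall>t\<ge>0.
      let f = \<lambda>s. blinfun_apply (T\<^sub>0 (t - s))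
                (blinfun_apply (B s) (blinfun_apply (cadjoint (B s)) (blinfun_apply (U s 0) x)))
      in f integrable_on {0..t} \<and>
         blinfun_apply (U t 0) x = blinfun_apply (T\<^sub>0 t) x - integral {0..t} f)"

section \<open>Observability\<close>

text \<open>\<open>S\<close> is the solution map from time \<open>0\<close>, namely \<open>S t = U t 0\<close> for the pair
  \<open>(B\<^sup>*, A)\<close> and \<open>S = T\<^sub>0\<close> for \<open>(B\<^sup>*, A\<^sub>0)\<close>.\<close>

definition observed_energy ::
    "(real \<Rightarrow> 'v::chilbert_space \<Rightarrow>\<^sub>L 'x::chilbert_space) \<Rightarrow> (real \<Rightarrow> 'x \<Rightarrow>\<^sub>L 'x) \<Rightarrow> real \<Rightarrow> 'x \<Rightarrow> real"
  where "observed_energy B S \<tau> x =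
    (LINT t:{0..\<tau>}|lebesgue. (norm (blinfun_apply (cadjoint (B t)) (blinfun_apply (S t) x)))\<^sup>2)"

definition approx_observable ::
    "'x set \<Rightarrow> (real \<Rightarrow> 'v::chilbert_space \<Rightarrow>\<^sub>L 'x::chilbert_space) \<Rightarrow> (real \<Rightarrow> 'x \<Rightarrow>\<^sub>L 'x) \<Rightarrow> real \<Rightarrow> bool"
  where "approx_observable Z B S \<tau> \<longleftrightarrow> (\<forall>x\<in>Z. observed_energy B S \<tau> x = 0 \<longrightarrow> x = 0)"

definition exactly_observable ::
    "'x set \<Rightarrow> (real \<Rightarrow> 'v::chilbert_space \<Rightarrow>\<^sub>L 'x::chilbert_space) \<Rightarrow> (real \<Rightarrow> 'x \<Rightarrow>\<^sub>L 'x) \<Rightarrow> real \<Rightarrow> bool"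
  where "exactly_observable Z B S \<tau> \<longleftrightarrow>
    (\<exists>\<kappa>>0. \<forall>x\<in>Z. observed_energy B S \<tau> x \<ge> \<kappa>\<^sup>2 * (norm x)\<^sup>2)"

end

theory Submission imports Defs begin

text \<open>
  Write \<open>z t = U t 0 x\<close>, \<open>a = B\<^sup>* z\<close> and \<open>b = B\<^sup>* (T\<^sub>0 x - z)\<close>, so that the undamped
  observation is \<open>B\<^sup>* T\<^sub>0 x = a + b\<close> and the damped one is \<open>a\<close>. Pulling Duhamel's formula
  back by the group gives \<open>T\<^sub>0 t x - z t = T\<^sub>0 t (v t)\<close>, where \<open>v\<close> is the indefinite integral of
  \<open>g s = T\<^sub>0 (- s) (B s (a s))\<close>.

  Upper bound: unitarity turns \<open>\<langle>b, a\<rangle>\<close> into \<open>\<langle>v, g\<rangle>\<close>, and since \<open>v\<close> is a primitive of \<open>g\<close>, the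
  integral of \<open>\<langle>v, g\<rangle>\<close> is half of \<open>\<parallel>v \<tau>\<parallel>\<^sup>2\<close>. So \<open>a\<close> and \<open>b\<close> have a nonnegative
  \<open>L\<^sup>2\<close> inner product, and adding \<open>b\<close> to \<open>a\<close> cannot decrease the energy
  (\<open>norm_square_indefinite_integral\<close>).

  Lower bound: \<open>\<parallel>b t\<parallel> \<le> \<parallel>B t\<parallel> \<parallel>v t\<parallel>\<close>, and \<open>\<parallel>v t\<parallel>\<close> is at most the integral of
  \<open>\<parallel>B\<parallel> \<parallel>a\<parallel>\<close>, which Cauchy-Schwarz bounds by \<open>\<parallel>B\<parallel> \<parallel>a\<parallel>\<close> in the \<open>L\<^sup>2\<close> norms. Hence
  \<open>\<parallel>b\<parallel> \<le> \<parallel>B\<parallel>\<^sup>2 \<parallel>a\<parallel>\<close> and \<open>\<parallel>a + b\<parallel> \<le> c \<parallel>a\<parallel>\<close> in \<open>L\<^sup>2\<close>.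

  Both arguments use only the real inner product. The energies are Lebesgue integrals of real
  functions, whose measurability comes from the strong measurability of \<open>B\<close>
  (\<open>borel_measurable_caratheodory_compose\<close>) and from the continuity of the adjoint map
  (\<open>bounded_linear_real_adjoint\<close>); the existence of adjoints rests on the Riesz representation
  theorem.
\<close>

section \<open>Adjoints of bounded operators\<close>

text \<open>The representing vector is the minimiser of \<open>\<parallel>x\<parallel>\<^sup>2 - 2 f x\<close>. By the parallelogram law every
  minimising sequence is Cauchy, and the first variation vanishes at the limit.\<close>

lemma riesz_representation:
  fixes f :: "'a::{real_inner, banach} \<Rightarrow> real"
  assumes "bounded_linear f"
  shows "\<exists>y. \<forall>x. f x = inner x y"
proof -
  interpret bounded_linear f by fact
  obtain K where K: "\<And>x. norm (f x) \<le> norm x * K"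
    using bounded by blast
  define q where "q x = inner x x - 2 * f x" for x
  define I where "I = Inf (range q)"
  have lower: "- K\<^sup>2 \<le> q x" for x
  proof -
    have "2 * f x \<le> 2 * (norm x * K)"
      using K[of x] by simp
    moreover have "0 \<le> (norm x - K)\<^sup>2" by simp
    ultimately show ?thesis
      by (simp add: q_def dot_square_norm power2_eq_square algebra_simps)
  qed
  then have bdd: "bdd_below (range q)" by (intro bdd_belowI2)
  then have I_le: "I \<le> q x" for x
    unfolding I_def by (intro cInf_lower) auto
  have "\<exists>x. q x < I + inverse (real (Suc n))" for n
    using cInf_lessD[of "range q" "I + inverse (real (Suc n))"] by (auto simp: I_def)
  then obtain u where u: "\<And>n. q (u n) < I + inverse (real (Suc n))" by metis
  have parallelogram: "(norm (x - y))\<^sup>2 \<le> 2 * (q x - I) + 2 * (q y - I)" for x y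
  proof -
    have "4 * q ((1/2) *\<^sub>R (x + y)) = 2 * q x + 2 * q y - (norm (x - y))\<^sup>2"
      by (simp add: q_def scaleR add inner_commute power2_norm_eq_inner algebra_simps)
    with I_le[of "(1/2) *\<^sub>R (x + y)"] show ?thesis by simp
  qed
  have "Cauchy u"
  proof (rule metric_CauchyI)
    fix e :: real assume "e > 0"
    then obtain M where M: "inverse (real (Suc M)) < e\<^sup>2 / 4"
      using reals_Archimedean[of "e\<^sup>2 / 4"] by auto
    have "dist (u m) (u n) < e" if "m \<ge> M" "n \<ge> M" for m n
    proof -
      have small: "q (u k) - I < e\<^sup>2 / 4" if "k \<ge> M" for k
      proof -
        have "inverse (real (Suc k)) \<le> inverse (real (Suc M))"
          using that by (intro le_imp_inverse_le) auto
        with u[of k] M show ?thesis by linarith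
      qed
      have "(norm (u m - u n))\<^sup>2 < e\<^sup>2"
      proof -
        have "2 * (q (u m) - I) + 2 * (q (u n) - I) < 2 * (e\<^sup>2 / 4) + 2 * (e\<^sup>2 / 4)"
          using small[OF that(1)] small[OF that(2)]
          by (intro add_strict_mono mult_strict_left_mono) auto
        with parallelogram[of "u m" "u n"] show ?thesis by simp
      qed
      with \<open>e > 0\<close> show ?thesis
        by (simp add: dist_norm power2_less_imp_less)
    qed
    then show "\<exists>M. \<forall>m\<ge>M. \<forall>n\<ge>M. dist (u m) (u n) < e" by blast
  qed
  then obtain y where y: "u \<longlonglongrightarrow> y"
    using Cauchy_convergent convergent_def by blast
  have "(\<lambda>n. q (u n)) \<longlonglongrightarrow> q y"
    unfolding q_def by (intro tendsto_intros tendsto y)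
  moreover have "(\<lambda>n. I + inverse (real (Suc n))) \<longlonglongrightarrow> I"
    using tendsto_add[OF tendsto_const LIMSEQ_inverse_real_of_nat, of I] by simp
  ultimately have "q y \<le> I"
    using u by (intro LIMSEQ_le[of "\<lambda>n. q (u n)" "q y"]) (auto intro: less_imp_le)
  then have min: "q y \<le> q x" for x
    using I_le order_trans by blast
  have "f x = inner x y" for x
  proof (rule ccontr)
    define d where "d = inner x y - f x"
    define n where "n = inner x x + 1"
    assume "f x \<noteq> inner x y"
    then have "d \<noteq> 0" by (simp add: d_def)
    have n: "n > 0" "inner x x = n - 1"
      unfolding n_def using inner_ge_zero[of x] by linarith+
    \<comment> \<open>The step that nearly minimises the quadratic polynomial \<open>t \<mapsto> q (y + t *\<^sub>R x)\<close>; the added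
      \<open>1\<close> in \<open>n\<close> covers \<open>x = 0\<close>.\<close>
    define t where "t = - d / n"
    have td: "t * n = - d" using n by (simp add: t_def)
    have "q (y + t *\<^sub>R x) = q y + 2 * t * d + t * t * (n - 1)"
      by (simp add: q_def d_def add scaleR inner_commute algebra_simps flip: n(2))
    also have "\<dots> = q y + 2 * t * d + t * (t * n) - t * t"
      by (simp add: algebra_simps)
    also have "\<dots> = q y - d\<^sup>2 / n - t\<^sup>2"
      unfolding td by (simp add: t_def power2_eq_square)
    finally have "q (y + t *\<^sub>R x) = q y - d\<^sup>2 / n - t\<^sup>2" .
    moreover have "d\<^sup>2 / n > 0" using \<open>d \<noteq> 0\<close> n by simp
    ultimately show False using min[of "y + t *\<^sub>R x"] zero_le_power2[of t] by linarith
  qed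
  then show ?thesis by blast
qed

lemma norm_adjoint_vector_le:
  fixes F :: "'a::real_inner \<Rightarrow>\<^sub>L 'b::real_inner"
  assumes "\<And>x. inner (blinfun_apply F x) y = inner x g"
  shows "norm g \<le> norm F * norm y"
proof (cases "g = 0")
  case False
  have "norm g * norm g = inner (F g) y"
    by (simp add: assms flip: power2_norm_eq_inner power2_eq_square)
  also have "\<dots> \<le> norm (F g) * norm y" by (rule norm_cauchy_schwarz)
  also have "\<dots> \<le> norm F * norm g * norm y"
    by (intro mult_right_mono norm_blinfun) auto
  finally have "norm g * norm g \<le> norm g * (norm F * norm y)"
    by (simp add: mult_ac)
  with False show ?thesis
    using mult_left_le_imp_le[of "norm g" "norm g" "norm F * norm y"] by simp
qed simp

lemma ex_real_adjoint:
  fixes F :: "'a::{real_inner, banach} \<Rightarrow>\<^sub>L 'b::real_inner"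
  shows "\<exists>G. \<forall>x y. inner (blinfun_apply F x) y = inner x (blinfun_apply G y)"
proof -
  have "\<exists>w. \<forall>x. inner (F x) y = inner x w" for y
    by (rule riesz_representation)
      (intro bounded_linear_intros blinfun.bounded_linear_right)
  then obtain g where g: "\<And>x y. inner (F x) y = inner x (g y)" by metis
  have eqI: "a = b" if "\<And>x. inner x a = inner x b" for a b :: 'a
  proof -
    have "inner (a - b) (a - b) = 0"
      unfolding inner_diff_right that by simp
    then show ?thesis by simp
  qed
  have "bounded_linear g"
  proof (rule bounded_linear_intro)
    show "g (x + y) = g x + g y" for x y
      by (rule eqI) (simp add: inner_add_right flip: g)
    show "g (r *\<^sub>R x) = r *\<^sub>R g x" for r x
      by (rule eqI) (simp flip: g)
    show "norm (g y) \<le> norm y * norm F" for y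
      using norm_adjoint_vector_le[OF g] by (simp add: mult.commute)
  qed
  then show ?thesis
    using g by (intro exI[of _ "Blinfun g"]) (simp add: bounded_linear_Blinfun_apply)
qed

text \<open>This adjoint exists for every bounded real-linear operator, whereas \<open>cadjoint\<close> is specified
  only on the complex-linear ones. Simple functions that approximate an operator-valued function
  need not take complex-linear values, so measurability arguments require the former.\<close>

definition real_adjoint ::
    "('a::{real_inner, banach} \<Rightarrow>\<^sub>L 'b::real_inner) \<Rightarrow> 'b \<Rightarrow>\<^sub>L 'a"
  where "real_adjoint F =
    (SOME G. \<forall>x y. inner (blinfun_apply F x) y = inner x (blinfun_apply G y))"

lemma inner_real_adjoint: "inner (blinfun_apply F x) y = inner x (real_adjoint F y)"
  using someI_ex[OF ex_real_adjoint[of F]] unfolding real_adjoint_def by blast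

lemma real_adjoint_unique:
  assumes "\<And>x y. inner (blinfun_apply F x) y = inner x (blinfun_apply G y)"
  shows "G = real_adjoint F"
proof (rule blinfun_eqI)
  fix y
  have "inner (G y - real_adjoint F y) (G y - real_adjoint F y) = 0"
    unfolding inner_diff_right by (simp flip: assms inner_real_adjoint)
  then show "G y = real_adjoint F y" by simp
qed

lemma norm_real_adjoint_le: "norm (real_adjoint F) \<le> norm F"
proof (rule norm_blinfun_bound)
  show "norm (real_adjoint F y) \<le> norm F * norm y" for y
    by (rule norm_adjoint_vector_le[OF inner_real_adjoint])
qed simp

text \<open>Gives the continuity of \<open>F \<mapsto> real_adjoint F\<close> in the operator norm, through which strong
  measurability of \<open>B\<close> passes to functions of its adjoints.\<close>

lemma bounded_linear_real_adjoint: "bounded_linear real_adjoint"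
proof (rule bounded_linear_intro[where K = 1])
  show "real_adjoint (F + G) = real_adjoint F + real_adjoint G"
    for F G :: "'a::{real_inner, banach} \<Rightarrow>\<^sub>L 'b::real_inner"
    by (rule real_adjoint_unique[symmetric])
      (simp add: blinfun.add_left inner_add_left inner_add_right inner_real_adjoint)
  show "real_adjoint (r *\<^sub>R F) = r *\<^sub>R real_adjoint F"
    for r and F :: "'a::{real_inner, banach} \<Rightarrow>\<^sub>L 'b::real_inner"
    by (rule real_adjoint_unique[symmetric])
      (simp add: blinfun.scaleR_left inner_real_adjoint)
qed (simp add: norm_real_adjoint_le)

lemma Im_cinner: "Im (cinner u v) = - inner (\<i> *\<^sub>C u) v"
  by (simp add: inner_eq_Re_cinner cinner_scaleC_left)

text \<open>For complex-linear \<open>F\<close> the imaginary part of \<open>cinner\<close> is recovered from the real inner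
  product by multiplying one argument by \<open>\<i>\<close>, so the identity of the real parts suffices.\<close>

lemma cadjoint_eq_real_adjoint:
  assumes "clinear_op F"
  shows "cadjoint F = real_adjoint F"
  unfolding cadjoint_def
proof (rule the_equality)
  show "\<forall>x y. cinner (F x) y = cinner x (real_adjoint F y)"
  proof (intro allI complex_eqI)
    fix x y
    show "Re (cinner (F x) y) = Re (cinner x (real_adjoint F y))"
      by (simp add: inner_real_adjoint flip: inner_eq_Re_cinner)
    have "\<i> *\<^sub>C F x = F (\<i> *\<^sub>C x)"
      using assms by (simp add: clinear_op_def)
    then show "Im (cinner (F x) y) = Im (cinner x (real_adjoint F y))"
      by (simp add: Im_cinner inner_real_adjoint)
  qed
  show "G = real_adjoint F" if "\<forall>x y. cinner (F x) y = cinner x (blinfun_apply G y)" for G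
    using that by (intro real_adjoint_unique) (simp add: inner_eq_Re_cinner)
qed

section \<open>Scalar functions of a strongly measurable function\<close>

text \<open>With a simple function in place of \<open>B\<close>, the composition is a finite combination of the
  measurable functions \<open>h F\<close> cut off to measurable sets; continuity in the first argument passes
  this to the limit almost everywhere, and Lebesgue measure is complete. The
  values of \<open>h\<close> are real so that the lemma applies to norms and inner products of functions into
  spaces that may fail to be separable.\<close>

lemma borel_measurable_caratheodory_compose:
  fixes h :: "'b::t2_space \<Rightarrow> 'a::euclidean_space \<Rightarrow> real"
  assumes S: "S \<in> sets lebesgue"
    and B: "strongly_measurable (lebesgue_on S) B"
    and meas: "\<And>F. h F \<in> borel_measurable (lebesgue_on S)"
    and cont: "\<And>t F. t \<in> S \<Longrightarrow> isCont (\<lambda>F. h F t) F"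
  shows "(\<lambda>t. h (B t) t) \<in> borel_measurable (lebesgue_on S)"
proof -
  obtain s where s: "\<And>i::nat. simple_function (lebesgue_on S) (s i)"
    and lim: "AE t in lebesgue_on S. (\<lambda>i. s i t) \<longlonglongrightarrow> B t"
    using B unfolding strongly_measurable_def by blast
  have simple: "(\<lambda>t. h (s i t) t) \<in> borel_measurable (lebesgue_on S)" for i
  proof -
    let ?R = "s i ` space (lebesgue_on S)"
    have fin: "finite ?R" by (rule simple_functionD(1)[OF s])
    have "(\<lambda>t. \<Sum>F\<in>?R. indicator (s i -` {F} \<inter> space (lebesgue_on S)) t * h F t)
        \<in> borel_measurable (lebesgue_on S)"
      by (intro borel_measurable_sum borel_measurable_times borel_measurable_indicator
          simple_functionD(2)[OF s] meas)
    moreover have "(\<Sum>F\<in>?R. indicator (s i -` {F} \<inter> space (lebesgue_on S)) t * h F t)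
        = h (s i t) t" if "t \<in> space (lebesgue_on S)" for t
    proof -
      have "(\<Sum>F\<in>?R. indicator (s i -` {F} \<inter> space (lebesgue_on S)) t * h F t)
          = (\<Sum>F\<in>?R. if F = s i t then h F t else 0)"
        using that by (intro sum.cong) (auto simp: indicator_def)
      then show ?thesis using fin that by simp
    qed
    ultimately show ?thesis by (rule measurable_cong[THEN iffD1, rotated])
  qed
  have limh: "AE t in lebesgue_on S. (\<lambda>i. h (s i t) t) \<longlonglongrightarrow> h (B t) t"
    using lim AE_space
  proof eventually_elim
    case (elim t)
    with cont[of t "B t"] show ?case
      by (auto intro: isCont_tendsto_compose)
  qed
  from AE_E[OF limh] obtain N
    where N: "{t \<in> space (lebesgue_on S). \<not> (\<lambda>i. h (s i t) t) \<longlonglongrightarrow> h (B t) t} \<subseteq> N"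
      "emeasure (lebesgue_on S) N = 0" "N \<in> sets (lebesgue_on S)" by blast
  have "(\<lambda>t. if t \<in> N then 0 else h (B t) t) \<in> borel_measurable (lebesgue_on S)"
  proof (rule borel_measurable_LIMSEQ_real)
    show "(\<lambda>i. if t \<in> N then 0 else h (s i t) t)
        \<longlonglongrightarrow> (if t \<in> N then 0 else h (B t) t)" if "t \<in> space (lebesgue_on S)" for t
      using N(1) that by (cases "t \<in> N") auto
    show "(\<lambda>t. if t \<in> N then 0 else h (s i t) t) \<in> borel_measurable (lebesgue_on S)" for i
      using N(3) simple by (intro measurable_If_set) auto
  qed
  then have "(\<lambda>t. if t \<in> S then if t \<in> N then 0 else h (B t) t else 0)
      \<in> borel_measurable lebesgue"
    by (simp add: borel_measurable_if S)
  moreover have "AE t in lebesgue.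
      (if t \<in> S then if t \<in> N then 0 else h (B t) t else 0) = (if t \<in> S then h (B t) t else 0)"
  proof (rule AE_I')
    show "N \<in> null_sets lebesgue"
      using N(2,3) S by (auto simp: null_sets_def emeasure_restrict_space sets_restrict_space)
  qed auto
  ultimately have "(\<lambda>t. if t \<in> S then h (B t) t else 0) \<in> borel_measurable lebesgue"
    by (rule borel_measurable_AE)
  then show ?thesis by (simp add: borel_measurable_if S)
qed

section \<open>Real and Hilbert space valued integrals\<close>

text \<open>The usual discriminant argument: the integral of \<open>(f - l g)\<^sup>2\<close> is nonnegative for all
  \<open>l\<close>.\<close>

lemma integral_cauchy_schwarz:
  fixes f g :: "'a::euclidean_space \<Rightarrow> real"
  assumes f: "(\<lambda>t. (f t)\<^sup>2) integrable_on S" and g: "(\<lambda>t. (g t)\<^sup>2) integrable_on S"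
    and fg: "(\<lambda>t. f t * g t) integrable_on S"
  shows "(integral S (\<lambda>t. f t * g t))\<^sup>2
    \<le> integral S (\<lambda>t. (f t)\<^sup>2) * integral S (\<lambda>t. (g t)\<^sup>2)"
proof -
  define P Q J where "P = integral S (\<lambda>t. (f t)\<^sup>2)" and "Q = integral S (\<lambda>t. (g t)\<^sup>2)"
    and "J = integral S (\<lambda>t. f t * g t)"
  have pos: "P \<ge> 0" "Q \<ge> 0" unfolding P_def Q_def by (auto intro!: integral_nonneg f g)
  have quad: "2 * l * J \<le> P + l\<^sup>2 * Q" for l
  proof -
    have "integral S (\<lambda>t. (2 * l) * (f t * g t)) \<le> integral S (\<lambda>t. (f t)\<^sup>2 + l\<^sup>2 * (g t)\<^sup>2)"
    proof (rule integral_le)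
      show "2 * l * (f t * g t) \<le> (f t)\<^sup>2 + l\<^sup>2 * (g t)\<^sup>2" for t
        using zero_le_power2[of "f t - l * g t"]
        by (simp add: power2_eq_square algebra_simps)
    qed (intro integrable_add integrable_on_mult_right f g fg)+
    then show ?thesis
      by (simp add: integral_add f g integrable_on_mult_right P_def Q_def J_def)
  qed
  have "J\<^sup>2 \<le> P * Q"
  proof (cases "Q = 0")
    case True
    then have "J = 0"
      \<comment> \<open>For \<open>Q = 0\<close> the bound \<open>2 * l * J \<le> P\<close> holds for all \<open>l\<close>; this \<open>l\<close> makes its left-hand
        side equal to \<open>2 * P + 2 > P\<close>.\<close>
      using quad[of "(P + 1) / J"] pos by (cases "J = 0") auto
    then show ?thesis using pos by simp
  next
    case False
    with pos have "Q > 0" by simp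
    have "2 * (J / Q) * J \<le> P + (J / Q)\<^sup>2 * Q" by (rule quad)
    also have "(J / Q)\<^sup>2 * Q = J\<^sup>2 / Q"
      using \<open>Q > 0\<close> by (simp add: power2_eq_square)
    finally have "J\<^sup>2 / Q \<le> P" by (simp add: power2_eq_square)
    then show ?thesis using \<open>Q > 0\<close> by (simp add: pos_divide_le_eq)
  qed
  then show ?thesis by (simp add: P_def Q_def J_def)
qed

text \<open>Along a fine partition the sum of the squared increments of \<open>G\<close> is at most the largest
  increment times the total variation \<open>G b - G a\<close>, and uniform continuity makes the largest
  increment arbitrarily small.\<close>

lemma quadratic_increments_imp_const:
  fixes F G :: "real \<Rightarrow> real"
  assumes "a \<le> b" and G: "continuous_on {a..b} G"
    and mono: "\<And>s t. a \<le> s \<Longrightarrow> s \<le> t \<Longrightarrow> t \<le> b \<Longrightarrow> G s \<le> G t"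
    and incr: "\<And>s t. a \<le> s \<Longrightarrow> s \<le> t \<Longrightarrow> t \<le> b \<Longrightarrow> \<bar>F t - F s\<bar> \<le> (G t - G s)\<^sup>2"
  shows "F b = F a"
proof -
  have "\<bar>F b - F a\<bar> \<le> 0 + e" if "e > 0" for e
  proof -
    \<comment> \<open>Bound for the single increments of \<open>G\<close>; the added \<open>1\<close> covers \<open>G b = G a\<close>.\<close>
    define d where "d = e / (G b - G a + 1)"
    have Gab: "G b - G a \<ge> 0" using mono[of a b] \<open>a \<le> b\<close> by simp
    then have d: "d > 0" "d * (G b - G a) \<le> e"
      using \<open>e > 0\<close> by (auto simp: d_def field_simps)
    have "uniformly_continuous_on {a..b} G"
      using G by (rule compact_uniformly_continuous) simp
    then obtain \<delta> where \<delta>: "\<delta> > 0"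
      "\<And>s t. s \<in> {a..b} \<Longrightarrow> t \<in> {a..b} \<Longrightarrow> dist t s < \<delta> \<Longrightarrow> dist (G t) (G s) < d"
      using d(1) unfolding uniformly_continuous_on_def by metis
    obtain n :: nat where n: "real n > (b - a) / \<delta>"
      using reals_Archimedean2 by blast
    have "n > 0" using n \<open>a \<le> b\<close> \<delta>(1) by (cases n) (auto simp: divide_less_0_iff)
    define h where "h = (b - a) / n"
    have h: "h \<ge> 0" "h < \<delta>" "n * h = b - a"
      using n \<open>a \<le> b\<close> \<open>n > 0\<close> \<delta>(1) by (auto simp: h_def field_simps)
    define p where "p i = a + real i * h" for i
    have p_mono: "p i \<le> p j" if "i \<le> j" for i j
      using that h by (auto simp: p_def intro!: mult_right_mono)
    have p0: "p 0 = a" and pn: "p n = b" using h by (auto simp: p_def)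
    have step: "\<bar>F (p (Suc i)) - F (p i)\<bar> \<le> d * (G (p (Suc i)) - G (p i))" if "i < n" for i
    proof -
      have le: "a \<le> p i" "p i \<le> p (Suc i)" "p (Suc i) \<le> b"
        using p_mono[of 0 i] p_mono[of i "Suc i"] p_mono[of "Suc i" n] that p0 pn by auto
      let ?D = "G (p (Suc i)) - G (p i)"
      have "?D \<ge> 0" using mono[OF le] by simp
      moreover have "dist (p (Suc i)) (p i) < \<delta>"
        using h by (simp add: p_def dist_real_def algebra_simps)
      then have "?D \<le> d"
        using \<delta>(2)[of "p i" "p (Suc i)"] le by (simp add: dist_real_def)
      ultimately have "?D\<^sup>2 \<le> d * ?D"
        by (simp add: power2_eq_square mult_right_mono)
      with incr[OF le] show ?thesis by linarith
    qed
    have "\<bar>F b - F a\<bar> = \<bar>\<Sum>i<n. F (p (Suc i)) - F (p i)\<bar>"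
      unfolding sum_lessThan_telescope[of "\<lambda>i. F (p i)" n] by (simp only: p0 pn)
    also have "\<dots> \<le> (\<Sum>i<n. \<bar>F (p (Suc i)) - F (p i)\<bar>)" by (rule sum_abs)
    also have "\<dots> \<le> (\<Sum>i<n. d * (G (p (Suc i)) - G (p i)))"
      by (intro sum_mono step) simp
    also have "\<dots> = d * (\<Sum>i<n. G (p (Suc i)) - G (p i))"
      by (simp only: sum_distrib_left)
    also have "\<dots> = d * (G b - G a)"
      unfolding sum_lessThan_telescope[of "\<lambda>i. G (p i)" n] by (simp only: p0 pn)
    finally show ?thesis using d(2) by simp
  qed
  then have "\<bar>F b - F a\<bar> \<le> 0" by (rule field_le_epsilon)
  then show ?thesis by simp
qed

lemma integral_diff_initial:
  fixes f :: "real \<Rightarrow> 'a::banach"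
  assumes "f integrable_on {a..b}" "a \<le> s" "s \<le> t" "t \<le> b"
  shows "integral {a..t} f - integral {a..s} f = integral {s..t} f"
  using Henstock_Kurzweil_Integration.integral_combine[of a s t f]
    integrable_subinterval_real[OF assms(1), of a t] assms(2-4)
  by (simp add: algebra_simps)

text \<open>The chain rule for \<open>\<parallel>v\<parallel>\<^sup>2\<close> with \<open>v\<close> the primitive of \<open>g\<close>. As \<open>v\<close> takes values in an
  arbitrary Hilbert space and \<open>g\<close> is merely integrable, it is not derived from differentiability
  almost everywhere: replacing \<open>v\<close> by its endpoint values on \<open>[s, t]\<close> makes an error
  of second order in the increment of the primitive of the majorant \<open>m\<close>, and
  \<open>quadratic_increments_imp_const\<close> applies.\<close>

lemma norm_square_indefinite_integral:
  fixes g :: "real \<Rightarrow> 'a::{real_inner, banach}"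
  assumes "a \<le> b" and g: "g integrable_on {a..b}" and m: "m integrable_on {a..b}"
    and gm: "\<And>s. s \<in> {a..b} \<Longrightarrow> norm (g s) \<le> m s"
    and vg: "(\<lambda>s. inner (integral {a..s} g) (g s)) integrable_on {a..b}"
  shows "2 * integral {a..b} (\<lambda>s. inner (integral {a..s} g) (g s))
    = (norm (integral {a..b} g))\<^sup>2"
proof -
  define v where "v t = integral {a..t} g" for t
  define G where "G t = integral {a..t} m" for t
  define k where "k s = inner (v s) (g s)" for s
  have k: "k integrable_on {a..b}" using vg unfolding k_def[abs_def] v_def .
  have sub: "g integrable_on {s..t}" "m integrable_on {s..t}" "k integrable_on {s..t}"
    if "a \<le> s" "t \<le> b" for s t
    using that by (auto intro!: integrable_subinterval_real[OF g] integrable_subinterval_real[OF m]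
        integrable_subinterval_real[OF k])
  have v_incr: "norm (v t - v s) \<le> G t - G s" if "a \<le> s" "s \<le> t" "t \<le> b" for s t
    unfolding v_def G_def integral_diff_initial[OF g that] integral_diff_initial[OF m that]
    using that by (intro Henstock_Kurzweil_Integration.integral_norm_bound_integral
        sub gm) auto
  have G_mono: "G s \<le> G t" if "a \<le> s" "s \<le> t" "t \<le> b" for s t
    using v_incr[OF that] norm_ge_zero[of "v t - v s"] by linarith
  define F where "F t = (norm (v t))\<^sup>2 / 2 - integral {a..t} k" for t
  have "F b = F a"
  proof (rule quadratic_increments_imp_const[OF \<open>a \<le> b\<close> _ G_mono])
    show "continuous_on {a..b} G"
      unfolding G_def by (rule indefinite_integral_continuous_1[OF m])
    fix s t assume st: "a \<le> s" "s \<le> t" "t \<le> b"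
    have gst: "g integrable_on {s..t}" and mst: "m integrable_on {s..t}"
      and kst: "k integrable_on {s..t}"
      using sub st by auto
    have lin: "((\<lambda>r. inner (v t + v s) (g r)) has_integral inner (v t + v s) (v t - v s)) {s..t}"
      using has_integral_linear[OF integrable_integral[OF gst] bounded_linear_inner_right]
      unfolding v_def integral_diff_initial[OF g st] by (simp add: o_def)
    have "2 * (F t - F s) = inner (v t + v s) (v t - v s) - 2 * (integral {a..t} k - integral {a..s} k)"
      by (simp add: F_def power2_norm_eq_inner inner_commute algebra_simps)
    also have "\<dots> = inner (v t + v s) (v t - v s) - 2 * integral {s..t} k"
      by (simp add: integral_diff_initial[OF k st])
    also have "\<dots> = integral {s..t} (\<lambda>r. inner (v t + v s) (g r) - 2 * k r)"
      using lin kst by (simp add: integral_diff has_integral_integrable integrable_on_mult_right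
          integral_unique)
    finally have eq: "2 * (F t - F s) = integral {s..t} (\<lambda>r. inner (v t + v s) (g r) - 2 * k r)" .
    have "norm (integral {s..t} (\<lambda>r. inner (v t + v s) (g r) - 2 * k r))
        \<le> integral {s..t} (\<lambda>r. (2 * (G t - G s)) * m r)"
    proof (rule Henstock_Kurzweil_Integration.integral_norm_bound_integral)
      show "(\<lambda>r. inner (v t + v s) (g r) - 2 * k r) integrable_on {s..t}"
        using lin kst by (intro integrable_diff integrable_on_mult_right) auto
      show "(\<lambda>r. 2 * (G t - G s) * m r) integrable_on {s..t}"
        by (intro integrable_on_mult_right mst)
      fix r assume r: "r \<in> {s..t}"
      \<comment> \<open>The symmetric choice \<open>v t + v s\<close> makes \<open>\<parallel>v t\<parallel>\<^sup>2 - \<parallel>v s\<parallel>\<^sup>2\<close> exact, so that only the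
        oscillation of \<open>v\<close> on \<open>[s, t]\<close> is left to estimate.\<close>
      have "inner (v t + v s) (g r) - 2 * k r = inner ((v t - v r) - (v r - v s)) (g r)"
        by (simp add: k_def algebra_simps)
      also have "norm \<dots> \<le> norm ((v t - v r) - (v r - v s)) * norm (g r)"
        using Cauchy_Schwarz_ineq2 by simp
      also have "\<dots> \<le> (2 * (G t - G s)) * m r"
      proof (rule mult_mono)
        have "norm ((v t - v r) - (v r - v s)) \<le> (G t - G r) + (G r - G s)"
          using norm_triangle_ineq4[of "v t - v r" "v r - v s"] v_incr[of r t] v_incr[of s r] r st
          by simp
        then show "norm ((v t - v r) - (v r - v s)) \<le> 2 * (G t - G s)"
          using G_mono[OF st] by simp
        show "norm (g r) \<le> m r" using gm r st by simp
      qed (use G_mono[OF st] in auto)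
      finally show "norm (inner (v t + v s) (g r) - 2 * k r) \<le> 2 * (G t - G s) * m r" .
    qed
    also have "\<dots> = 2 * (G t - G s) * (G t - G s)"
      by (simp add: G_def integral_diff_initial[OF m st])
    finally have "\<bar>2 * (F t - F s)\<bar> \<le> 2 * (G t - G s)\<^sup>2"
      unfolding eq real_norm_def by (simp only: power2_eq_square mult.assoc)
    then show "\<bar>F t - F s\<bar> \<le> (G t - G s)\<^sup>2"
      unfolding abs_mult by simp
  qed
  then have "2 * integral {a..b} k = (norm (v b))\<^sup>2"
    by (simp add: F_def v_def)
  then show ?thesis unfolding k_def[abs_def] v_def .
qed

section \<open>Comparison of the observed energies\<close>

lemma unitary_group_inner:
  "unitary_group T \<Longrightarrow> inner (blinfun_apply (T t) x) (blinfun_apply (T t) y) = inner x y"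
  by (simp add: unitary_group_def unitary_op_def inner_eq_Re_cinner)

lemma unitary_group_norm: "unitary_group T \<Longrightarrow> norm (blinfun_apply (T t) x) = norm x"
  by (simp add: norm_eq_sqrt_inner unitary_group_inner)

lemma unitary_group_add:
  assumes "unitary_group T"
  shows "blinfun_apply (T s) (blinfun_apply (T t) x) = blinfun_apply (T (s + t)) x"
proof -
  have "T (s + t) = T s o\<^sub>L T t" using assms by (auto simp: unitary_group_def)
  then show ?thesis by simp
qed

lemma unitary_group_zero: "unitary_group T \<Longrightarrow> blinfun_apply (T 0) x = x"
  by (simp add: unitary_group_def)

text \<open>The vectors \<open>z\<close>, \<open>a\<close>, \<open>b\<close>, \<open>g\<close>, \<open>v\<close> of the proof are those of the introduction, and
  \<open>e t = T t x - z t = T t (v t)\<close> is the deviation caused by the damping. For the second bound,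
  \<open>\<parallel>e t\<parallel> = \<parallel>v t\<parallel>\<close> is estimated by the number \<open>J\<close>, the integral of \<open>\<parallel>B\<parallel> \<parallel>a\<parallel>\<close> over all of
  \<open>[0, \<tau>]\<close>.\<close>

lemma observed_energy_bounds:
  fixes T :: "real \<Rightarrow> 'x::chilbert_space \<Rightarrow>\<^sub>L 'x" and B :: "real \<Rightarrow> 'v::chilbert_space \<Rightarrow>\<^sub>L 'x"
  assumes T: "unitary_group T" and B: "L2_loc B" and U: "associated_evolution_family T B U"
    and "\<tau> > 0"
  shows "observed_energy B (\<lambda>t. U t 0) \<tau> x \<le> observed_energy B T \<tau> x"
    and "observed_energy B T \<tau> x
      \<le> (1 + L2_norm_sq B \<tau>)\<^sup>2 * observed_energy B (\<lambda>t. U t 0) \<tau> x"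
proof -
  define z where "z t = U t 0 x" for t
  define e where "e t = T t x - z t" for t
  define a where "a t = real_adjoint (B t) (z t)" for t
  define b where "b t = real_adjoint (B t) (e t)" for t
  define g where "g t = T (- t) (B t (a t))" for t
  define v where "v t = integral {0..t} g" for t
  let ?S = "{0..\<tau>}"

  have adj: "cadjoint (B t) = real_adjoint (B t)" if "t \<ge> 0" for t
    using B that unfolding L2_loc_def by (intro cadjoint_eq_real_adjoint) blast
  have meas_B: "strongly_measurable (lebesgue_on ?S) B"
    and "set_integrable lebesgue ?S (\<lambda>t. (norm (B t))\<^sup>2)"
    using B \<open>\<tau> > 0\<close> unfolding L2_loc_def by blast+
  from this(2) have B2: "(\<lambda>t. (norm (B t))\<^sup>2) integrable_on ?S"
    and N: "L2_norm_sq B \<tau> = integral ?S (\<lambda>t. (norm (B t))\<^sup>2)"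
    by (simp_all add: L2_norm_sq_def set_lebesgue_integral_eq_integral)
  have S: "?S \<in> sets lebesgue" by simp

  have cont_z: "continuous_on ?S z"
  proof -
    have "continuous_on {(t, s). 0 \<le> s \<and> s \<le> t} (\<lambda>(t, s). U t s x)"
      using U unfolding associated_evolution_family_def evolution_family_def by blast
    then have "continuous_on ?S (\<lambda>t. (\<lambda>(t, s). U t s x) (t, 0))"
      by (rule continuous_on_compose2) (auto intro!: continuous_intros)
    then show ?thesis by (simp add: z_def[abs_def])
  qed
  have cont_T: "continuous_on ?S (\<lambda>t. T t x)"
    using T unfolding unitary_group_def by (blast intro: continuous_on_subset[OF _ subset_UNIV])
  have cont_e: "continuous_on ?S e"
    unfolding e_def[abs_def] by (intro continuous_intros cont_T cont_z)
  have norm_z: "norm (z t) \<le> norm x" if "t \<ge> 0" for t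
  proof -
    have "norm (U t 0) \<le> 1"
      using U that unfolding associated_evolution_family_def by blast
    then have "norm (U t 0) * norm x \<le> 1 * norm x" by (intro mult_right_mono) auto
    then show ?thesis
      using norm_blinfun[of "U t 0" x] by (simp add: z_def)
  qed
  have norm_e: "norm (e t) \<le> 2 * norm x" if "t \<ge> 0" for t
    using norm_triangle_ineq4[of "T t x" "z t"] norm_z[OF that]
    by (simp add: e_def unitary_group_norm[OF T])
  have norm_adj: "norm (real_adjoint (B t) w) \<le> norm (B t) * norm w" for t w
    by (rule norm_adjoint_vector_le[OF inner_real_adjoint])

  have cont_adj: "isCont (\<lambda>F::'v \<Rightarrow>\<^sub>L 'x. real_adjoint F w) F" for F w
    by (intro bounded_linear.isCont[OF blinfun.bounded_linear_left]
        bounded_linear.isCont[OF bounded_linear_real_adjoint] continuous_ident)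
  have cont_apply: "continuous_on ?S (\<lambda>t. real_adjoint F (w t))"
    if "continuous_on ?S w" for F :: "'v \<Rightarrow>\<^sub>L 'x" and w
    by (intro continuous_intros that)
  \<comment> \<open>Integrability of \<open>\<parallel>B\<^sup>* w\<parallel>\<^sup>2\<close> along bounded continuous curves \<open>w\<close>, to be used for
    \<open>z\<close>, \<open>e\<close> and \<open>T t x\<close>.\<close>
  have meas_norm_adj: "(\<lambda>t. (norm (real_adjoint (B t) (w t)))\<^sup>2) \<in> borel_measurable (lebesgue_on ?S)"
    if "continuous_on ?S w" for w
    by (rule borel_measurable_caratheodory_compose[OF S meas_B])
      (intro continuous_imp_measurable_on_sets_lebesgue continuous_intros cont_apply cont_adj that S)+
  have int_norm_adj: "(\<lambda>t. (norm (real_adjoint (B t) (w t)))\<^sup>2) absolutely_integrable_on ?S"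
    if w: "continuous_on ?S w" and K: "\<And>t. t \<ge> 0 \<Longrightarrow> norm (w t) \<le> K" for w K
  proof (rule measurable_bounded_by_integrable_imp_absolutely_integrable[OF meas_norm_adj[OF w] S])
    show "(\<lambda>t. (norm (B t))\<^sup>2 * K\<^sup>2) integrable_on ?S"
      by (intro integrable_on_mult_left B2)
    show "norm ((norm (real_adjoint (B t) (w t)))\<^sup>2) \<le> (norm (B t))\<^sup>2 * K\<^sup>2" if "t \<in> ?S" for t
    proof -
      have "norm (real_adjoint (B t) (w t)) \<le> norm (B t) * K"
        using norm_adj[of t "w t"] mult_left_mono[OF K[of t] norm_ge_zero[of "B t"]] that by simp
      then have "(norm (real_adjoint (B t) (w t)))\<^sup>2 \<le> (norm (B t) * K)\<^sup>2"
        by (intro power_mono) auto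
      then show ?thesis by (simp add: power_mult_distrib)
    qed
  qed
  have a2: "(\<lambda>t. (norm (a t))\<^sup>2) absolutely_integrable_on ?S"
    unfolding a_def using int_norm_adj[OF cont_z norm_z] .
  have b2: "(\<lambda>t. (norm (b t))\<^sup>2) absolutely_integrable_on ?S"
    unfolding b_def using int_norm_adj[OF cont_e norm_e] .
  have ab2: "(\<lambda>t. (norm (a t + b t))\<^sup>2) absolutely_integrable_on ?S"
  proof -
    have "a t + b t = real_adjoint (B t) (T t x)" for t
      by (simp add: a_def b_def e_def flip: blinfun.add_right)
    then show ?thesis
      using int_norm_adj[OF cont_T, of "norm x"] by (simp add: unitary_group_norm[OF T])
  qed
  note a2i = set_lebesgue_integral_eq_integral(1)[OF a2]
    and b2i = set_lebesgue_integral_eq_integral(1)[OF b2]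
    and ab2i = set_lebesgue_integral_eq_integral(1)[OF ab2]
  define E where "E = integral ?S (\<lambda>t. (norm (a t))\<^sup>2)"
  have "E \<ge> 0" unfolding E_def by (intro integral_nonneg a2i) auto
  have energy_U: "observed_energy B (\<lambda>t. U t 0) \<tau> x = E"
  proof -
    have "observed_energy B (\<lambda>t. U t 0) \<tau> x = (LINT t:?S|lebesgue. (norm (a t))\<^sup>2)"
      unfolding observed_energy_def
      by (intro set_lebesgue_integral_cong) (auto simp: a_def z_def adj)
    then show ?thesis by (simp add: E_def set_lebesgue_integral_eq_integral(2)[OF a2])
  qed
  have energy_T: "observed_energy B T \<tau> x = integral ?S (\<lambda>t. (norm (a t + b t))\<^sup>2)"
  proof -
    have "observed_energy B T \<tau> x = (LINT t:?S|lebesgue. (norm (a t + b t))\<^sup>2)"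
      unfolding observed_energy_def
      by (intro set_lebesgue_integral_cong)
        (auto simp: a_def b_def e_def adj simp flip: blinfun.add_right)
    then show ?thesis by (simp add: set_lebesgue_integral_eq_integral(2)[OF ab2])
  qed

  \<comment> \<open>Duhamel's formula pulled back by \<open>T (- t)\<close>: its integrand \<open>T (t - s) (B s (a s))\<close>
    becomes \<open>g s\<close>, which is independent of \<open>t\<close>.\<close>
  have g_int: "g integrable_on {0..t}" and e_v: "e t = T t (v t)" if "t \<ge> 0" for t
  proof -
    let ?f = "\<lambda>s. T (t - s) (B s (cadjoint (B s) (U s 0 x)))"
    have f: "?f integrable_on {0..t}" "z t = T t x - integral {0..t} ?f"
      using U that unfolding associated_evolution_family_def Let_def z_def by blast+
    have g_f: "T (- t) (?f s) = g s" if "s \<in> {0..t}" for s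
      using that by (simp add: g_def a_def z_def adj unitary_group_add[OF T])
    have "((\<lambda>s. T (- t) (?f s)) has_integral T (- t) (integral {0..t} ?f)) {0..t}"
      using has_integral_linear[OF integrable_integral[OF f(1)] blinfun.bounded_linear_right]
      by (simp add: o_def)
    then have "(g has_integral T (- t) (integral {0..t} ?f)) {0..t}"
      by (rule has_integral_eq[rotated]) (simp add: g_f)
    then have "g integrable_on {0..t}" and "v t = T (- t) (integral {0..t} ?f)"
      by (auto simp: v_def integral_unique)
    then show "g integrable_on {0..t}" and "e t = T t (v t)"
      by (simp_all add: e_def f(2) unitary_group_add[OF T] unitary_group_zero[OF T])
  qed
  define m where "m t = norm (B t) * norm (a t)" for t
  have m_int: "m integrable_on ?S"
  proof (rule measurable_bounded_by_integrable_imp_integrable_real)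
    show "m \<in> borel_measurable (lebesgue_on ?S)"
      unfolding m_def[abs_def] a_def
      by (rule borel_measurable_caratheodory_compose[OF S meas_B])
        (intro continuous_imp_measurable_on_sets_lebesgue continuous_intros cont_apply cont_adj
          cont_z S)+
    show "(\<lambda>t. (norm (B t))\<^sup>2 * norm x) integrable_on ?S"
      by (intro integrable_on_mult_left B2)
    show "\<bar>m t\<bar> \<le> (norm (B t))\<^sup>2 * norm x" if "t \<in> ?S" for t
    proof -
      have "norm (a t) \<le> norm (B t) * norm x"
        using norm_adj[of t "z t"] mult_left_mono[OF norm_z[of t] norm_ge_zero[of "B t"]] that
        by (simp add: a_def)
      then have "norm (B t) * norm (a t) \<le> norm (B t) * (norm (B t) * norm x)"
        by (intro mult_left_mono) auto
      then show ?thesis by (simp add: m_def power2_eq_square mult_ac)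
    qed
  qed (rule S)
  have g_m: "norm (g t) \<le> m t" for t
    unfolding g_def m_def unitary_group_norm[OF T] by (rule norm_blinfun)
  \<comment> \<open>Conjugation by the unitary \<open>T t\<close> identifies the cross term of \<open>\<parallel>a + b\<parallel>\<^sup>2\<close> with the
    integrand of the chain rule for \<open>\<parallel>v\<parallel>\<^sup>2\<close>.\<close>
  have vg: "inner (v t) (g t) = inner (b t) (a t)" if "t \<ge> 0" for t
  proof -
    have "inner (v t) (g t) = inner (T t (v t)) (T t (g t))"
      by (simp add: unitary_group_inner[OF T])
    also have "\<dots> = inner (e t) (B t (a t))"
      using that by (simp add: e_v g_def unitary_group_add[OF T] unitary_group_zero[OF T])
    also have "\<dots> = inner (b t) (a t)"
      by (metis b_def inner_commute inner_real_adjoint)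
    finally show ?thesis .
  qed
  have polar: "2 * inner (b t) (a t) = (norm (a t + b t))\<^sup>2 - (norm (a t))\<^sup>2 - (norm (b t))\<^sup>2" for t
    by (simp add: power2_norm_eq_inner inner_commute algebra_simps)
  have ba_int: "(\<lambda>t. inner (b t) (a t)) integrable_on ?S"
  proof -
    have "(\<lambda>t. 2 * inner (b t) (a t)) integrable_on ?S"
      unfolding polar by (intro integrable_diff a2i b2i ab2i)
    then show ?thesis by simp
  qed

  have nonneg: "integral ?S (\<lambda>t. inner (b t) (a t)) \<ge> 0"
  proof -
    have "integral ?S (\<lambda>t. inner (b t) (a t)) = integral ?S (\<lambda>t. inner (integral {0..t} g) (g t))"
      by (rule integral_cong) (simp add: vg flip: v_def)
    moreover have "(\<lambda>t. inner (integral {0..t} g) (g t)) integrable_on ?S"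
      by (rule integrable_eq[OF ba_int]) (simp add: vg flip: v_def)
    ultimately show ?thesis
      using norm_square_indefinite_integral[of 0 \<tau> g m] g_int[of \<tau>] m_int g_m \<open>\<tau> > 0\<close>
      by (smt (verit) zero_le_power2)
  qed
  show "observed_energy B (\<lambda>t. U t 0) \<tau> x \<le> observed_energy B T \<tau> x"
  proof -
    have "E + 2 * integral ?S (\<lambda>t. inner (b t) (a t))
        = integral ?S (\<lambda>t. (norm (a t))\<^sup>2 + 2 * inner (b t) (a t))"
      unfolding E_def by (simp add: integral_add a2i ba_int integrable_on_mult_right)
    also have "\<dots> \<le> integral ?S (\<lambda>t. (norm (a t + b t))\<^sup>2)"
      by (intro integral_le integrable_add integrable_on_mult_right a2i ba_int ab2i)
        (simp add: polar)
    finally show ?thesis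
      using nonneg unfolding energy_U energy_T by simp
  qed

  define J where "J = integral ?S m"
  have "J\<^sup>2 \<le> L2_norm_sq B \<tau> * E"
    unfolding J_def m_def[abs_def] N E_def
    using m_int by (intro integral_cauchy_schwarz B2 a2i) (simp add: m_def[abs_def])
  have norm_b: "norm (b t) \<le> norm (B t) * J" if "t \<in> ?S" for t
  proof -
    have mt: "m integrable_on {0..t}"
      using that by (intro integrable_subinterval_real[OF m_int]) auto
    have "norm (e t) = norm (v t)"
      using that by (simp add: e_v unitary_group_norm[OF T])
    also have "\<dots> \<le> integral {0..t} m"
      unfolding v_def using that
      by (intro Henstock_Kurzweil_Integration.integral_norm_bound_integral g_int mt g_m) auto
    also have "\<dots> \<le> J"
      unfolding J_def using that
      by (intro integral_subset_le mt m_int) (auto simp: m_def)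
    finally show ?thesis
      using norm_adj[of t "e t"] mult_left_mono[OF _ norm_ge_zero[of "B t"], of "norm (e t)" J]
      by (simp add: b_def)
  qed
  define n where "n = L2_norm_sq B \<tau>"
  have n: "n \<ge> 0" "J\<^sup>2 \<le> n * E"
    using \<open>J\<^sup>2 \<le> L2_norm_sq B \<tau> * E\<close> B2 by (auto simp: n_def N intro!: integral_nonneg)
  \<comment> \<open>A pointwise substitute for Minkowski's inequality, with weights chosen such that the integral
    of the right-hand side is exactly \<open>(1 + n)\<^sup>2 * E\<close>.\<close>
  have pointwise: "(norm (a t + b t))\<^sup>2 \<le> (1 + n) * (norm (a t))\<^sup>2 + (1 + n) * E * (norm (B t))\<^sup>2"
    if "t \<in> ?S" for t
  proof -
    define p where "p = norm (a t)"
    define q where "q = norm (B t)"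
    define r where "r = sqrt E"
    define k where "k = sqrt n"
    have sq: "r\<^sup>2 = E" "k\<^sup>2 = n" and ge: "r \<ge> 0" "k \<ge> 0" "p \<ge> 0" "q \<ge> 0"
      using \<open>E \<ge> 0\<close> n by (auto simp: r_def k_def p_def q_def)
    have "J \<le> k * r"
      using real_le_rsqrt[OF n(2)] by (simp add: k_def r_def real_sqrt_mult)
    then have "q * J \<le> q * (k * r)" using ge by (intro mult_left_mono)
    then have "norm (a t + b t) \<le> p + q * (k * r)"
      using norm_triangle_ineq[of "a t" "b t"] norm_b[OF that] unfolding p_def q_def by linarith
    then have "(norm (a t + b t))\<^sup>2 \<le> (p + q * (k * r))\<^sup>2"
      by (intro power_mono) auto
    \<comment> \<open>The added square cancels the cross term \<open>2 * p * q * k * r\<close>.\<close>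
    also have "\<dots> \<le> (p + q * (k * r))\<^sup>2 + (k * p - q * r)\<^sup>2" by simp
    also have "\<dots> = (1 + k\<^sup>2) * p\<^sup>2 + (1 + k\<^sup>2) * r\<^sup>2 * q\<^sup>2"
      by (simp add: power2_eq_square algebra_simps)
    finally show ?thesis by (simp add: sq p_def q_def)
  qed
  have "integral ?S (\<lambda>t. (norm (a t + b t))\<^sup>2)
      \<le> integral ?S (\<lambda>t. (1 + n) * (norm (a t))\<^sup>2 + (1 + n) * E * (norm (B t))\<^sup>2)"
    by (intro integral_le integrable_add integrable_on_mult_right a2i ab2i B2 pointwise)
  also have "\<dots> = (1 + n) * E + (1 + n) * E * n"
    by (simp add: integral_add integrable_on_mult_right a2i B2 E_def n_def N)
  also have "\<dots> = (1 + n)\<^sup>2 * E"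
    by (simp add: power2_eq_square algebra_simps)
  finally show "observed_energy B T \<tau> x
      \<le> (1 + L2_norm_sq B \<tau>)\<^sup>2 * observed_energy B (\<lambda>t. U t 0) \<tau> x"
    by (simp add: energy_U energy_T n_def)
qed

lemma observed_energy_nonneg: "observed_energy B S \<tau> x \<ge> 0"
  unfolding observed_energy_def set_lebesgue_integral_def
  by (intro Bochner_Integration.integral_nonneg) simp

theorem lemma3p3:
  fixes T\<^sub>0 :: "real \<Rightarrow> 'x::chilbert_space \<Rightarrow>\<^sub>L 'x"
    and A\<^sub>0 :: "('x \<times> 'x) set"
    and B :: "real \<Rightarrow> 'v::chilbert_space \<Rightarrow>\<^sub>L 'x"
    and A :: "real \<Rightarrow> ('x \<times> 'x) set"
    and U :: "real \<Rightarrow> real \<Rightarrow> 'x \<Rightarrow>\<^sub>L 'x"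
    and \<tau> :: real
  assumes "unitary_group T\<^sub>0"
    and "A\<^sub>0 = generator T\<^sub>0"
    and "L2_loc B"
    and "\<And>t. t \<ge> 0 \<Longrightarrow> A t = damped A\<^sub>0 (B t)"
    and "associated_evolution_family T\<^sub>0 B U"
    and "\<tau> > 0"
  defines "c \<equiv> 1 + L2_norm_sq B \<tau>"
  shows "(\<forall>x.
      1 / c\<^sup>2 * (LINT t:{0..\<tau>}|lebesgue. (norm (cadjoint (B t) (T\<^sub>0 t x)))\<^sup>2)
        \<le> (LINT t:{0..\<tau>}|lebesgue. (norm (cadjoint (B t) (U t 0 x)))\<^sup>2) \<and>
      (LINT t:{0..\<tau>}|lebesgue. (norm (cadjoint (B t) (U t 0 x)))\<^sup>2)
        \<le> (LINT t:{0..\<tau>}|lebesgue. (norm (cadjoint (B t) (T\<^sub>0 t x)))\<^sup>2)) \<and>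
    (\<forall>Z.
      (approx_observable Z B (\<lambda>t. U t 0) \<tau> \<longleftrightarrow> approx_observable Z B T\<^sub>0 \<tau>) \<and>
      (exactly_observable Z B (\<lambda>t. U t 0) \<tau> \<longleftrightarrow> exactly_observable Z B T\<^sub>0 \<tau>))"
proof -
  have "0 \<le> L2_norm_sq B \<tau>"
    unfolding L2_norm_sq_def set_lebesgue_integral_def
    by (intro Bochner_Integration.integral_nonneg) simp
  then have c: "c > 0" by (simp add: c_def)
  let ?E\<^sub>U = "observed_energy B (\<lambda>t. U t 0) \<tau>" and ?E\<^sub>0 = "observed_energy B T\<^sub>0 \<tau>"
  have upper: "?E\<^sub>U x \<le> ?E\<^sub>0 x" and bound: "?E\<^sub>0 x \<le> c\<^sup>2 * ?E\<^sub>U x" for x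
    using observed_energy_bounds[OF assms(1,3,5,6)] by (auto simp: c_def)
  have lower: "1 / c\<^sup>2 * ?E\<^sub>0 x \<le> ?E\<^sub>U x" for x
    using bound[of x] c by (simp add: divide_le_eq mult.commute)
  have zero: "?E\<^sub>U x = 0 \<longleftrightarrow> ?E\<^sub>0 x = 0" for x
    using upper[of x] bound[of x] observed_energy_nonneg[of B "\<lambda>t. U t 0" \<tau> x]
      observed_energy_nonneg[of B T\<^sub>0 \<tau> x] by auto
  have exact: "exactly_observable Z B (\<lambda>t. U t 0) \<tau> \<longleftrightarrow> exactly_observable Z B T\<^sub>0 \<tau>" for Z
  proof
    show "exactly_observable Z B T\<^sub>0 \<tau>" if "exactly_observable Z B (\<lambda>t. U t 0) \<tau>"
      using that upper order_trans unfolding exactly_observable_def by blast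
    assume "exactly_observable Z B T\<^sub>0 \<tau>"
    then obtain \<kappa> where \<kappa>: "\<kappa> > 0" "\<And>x. x \<in> Z \<Longrightarrow> \<kappa>\<^sup>2 * (norm x)\<^sup>2 \<le> ?E\<^sub>0 x"
      unfolding exactly_observable_def by blast
    have "(\<kappa> / c)\<^sup>2 * (norm x)\<^sup>2 \<le> ?E\<^sub>U x" if "x \<in> Z" for x
    proof -
      have "(\<kappa> / c)\<^sup>2 * (norm x)\<^sup>2 = 1 / c\<^sup>2 * (\<kappa>\<^sup>2 * (norm x)\<^sup>2)"
        by (simp add: power_divide)
      also have "\<dots> \<le> 1 / c\<^sup>2 * ?E\<^sub>0 x" by (intro mult_left_mono \<kappa> that) simp
      finally show ?thesis using lower[of x] by linarith
    qed
    moreover have "\<kappa> / c > 0" using \<kappa> c by simp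
    ultimately show "exactly_observable Z B (\<lambda>t. U t 0) \<tau>"
      unfolding exactly_observable_def by blast
  qed
  show ?thesis
    using lower upper zero exact unfolding approx_observable_def observed_energy_def by blast
qed

end
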